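(* Let $m\geq 3$ be an integer and let $\{X_n\}_{n\in\mathbb{N}}$ be a sequence of finite connected $2$-connected graphs such that, for each $n$, the number of maximal spanning trees of $X_n$ not containing a given edge $e$ is the same for all edges $e$ of $X_n$. Let $\widetilde{X}_n$ be the $\mathbb{Z}_m$-homology cover of $X_n$, equipped with its graph metric. If $\mathrm{girth}(X_n)\to\infty$ as $n\to\infty$, then the coarse disjoint union $\bigsqcup_n\widetilde{X}_n$ coarsely embeds into Hilbert space.
   Context: A graph is $2$-connected if removing any single edge leaves it connected. The girth of a graph is the length of its shortest cycle. $\mathbb{Z}_m$-homology cover: let $X$ be a finite connected graph with a chosen orientation of each edge, let $T$ be a maximal spanning tree, and let $e_1,\dots,e_r$ be the edges not in $T$, which correspond to a free basis of $\pi_1(X)$. Let $K=\pi_1(X)/[\pi_1(X),\pi_1(X)]\pi_1(X)^m\cong\oplus^r\mathbb{Z}_m$ and $\rho:\pi_1(X)\to K$ the quotient map. The cover $\widetilde{X}$ has vertex set $V(X)\times K$ and edge set $E(X)\times K$; if $e\in T$ goes from $v$ to $w$, the edge $(e,k)$ joins $(v,k)$ and $(w,k)$; if $e\notin T$ goes from $v$ to $w$, then $(e,k)$ joins $(v,k)$ and $(w,\rho(e)k)$. Up to isomorphism commuting with the projection $\pi:\widetilde{X}\to X$, $(v,k)\mapsto v$, $(e,k)\mapsto e$, this does not depend on $T$ or the orientations. A coarse embedding is a map $F$ with non-decreasing $\rho_\pm:\mathbb{R}_+\to\mathbb{R}_+$, $\rho_\pm(t)\to\infty$, and $\rho_-(d(x,x'))\le\|F(x)-F(x')\|\le\rho_+(d(x,x'))$.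 The coarse disjoint union of metric spaces $X_n$ is $\bigsqcup_n X_n$ with the metric restricting to the given one on each $X_n$, and distances between distinct components larger than their diameters and tending to infinity. *)

theory Defs
  imports "HOL-Analysis.Analysis" "HOL-Library.Extended_Nat"
begin

text \<open>Finite multigraphs (loops and parallel edges allowed): a vertex set V,
an edge set E, and each edge e oriented from s e to t e.\<close>

definition finite_graph :: "'v set \<Rightarrow> 'e set \<Rightarrow> ('e \<Rightarrow> 'v) \<Rightarrow> ('e \<Rightarrow> 'v) \<Rightarrow> bool" where
  "finite_graph V E s t \<longleftrightarrow> finite V \<and> finite E \<and> s ` E \<subseteq> V \<and> t ` E \<subseteq> V"

definition adj_rel :: "'e set \<Rightarrow> ('e \<Rightarrow> 'v) \<Rightarrow> ('e \<Rightarrow> 'v) \<Rightarrow> ('v \<times> 'v) set" where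
  "adj_rel E s t = {(s e, t e) | e. e \<in> E} \<union> {(t e, s e) | e. e \<in> E}"

definition graph_connected :: "'v set \<Rightarrow> 'e set \<Rightarrow> ('e \<Rightarrow> 'v) \<Rightarrow> ('e \<Rightarrow> 'v) \<Rightarrow> bool" where
  "graph_connected V E s t \<longleftrightarrow> (\<forall>u\<in>V. \<forall>v\<in>V. (u, v) \<in> (adj_rel E s t)\<^sup>*)"

text \<open>2-connected in the sense of the paper: removing any single edge leaves it connected.\<close>
definition two_connected :: "'v set \<Rightarrow> 'e set \<Rightarrow> ('e \<Rightarrow> 'v) \<Rightarrow> ('e \<Rightarrow> 'v) \<Rightarrow> bool" where
  "two_connected V E s t \<longleftrightarrow> (\<forall>e\<in>E. graph_connected V (E - {e}) s t)"

text \<open>A cycle of length k \<ge> 1: distinct edges es!i joining distinct vertices vs!i and vs!((i+1) mod k).\<close>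
definition is_cycle :: "'e set \<Rightarrow> ('e \<Rightarrow> 'v) \<Rightarrow> ('e \<Rightarrow> 'v) \<Rightarrow> 'e list \<Rightarrow> 'v list \<Rightarrow> bool" where
  "is_cycle E s t es vs \<longleftrightarrow>
     length es = length vs \<and> 1 \<le> length es \<and> distinct es \<and> distinct vs \<and> set es \<subseteq> E \<and>
     (\<forall>i<length es.
        (s (es ! i) = vs ! i \<and> t (es ! i) = vs ! ((i + 1) mod length es)) \<or>
        (t (es ! i) = vs ! i \<and> s (es ! i) = vs ! ((i + 1) mod length es)))"

definition girth :: "'e set \<Rightarrow> ('e \<Rightarrow> 'v) \<Rightarrow> ('e \<Rightarrow> 'v) \<Rightarrow> enat" where
  "girth E s t = Inf {enat (length es) | es vs. is_cycle E s t es vs}"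

text \<open>Maximal spanning tree: a connected, acyclic spanning subgraph (all vertices, edges T \<subseteq> E).\<close>
definition spanning_tree :: "'v set \<Rightarrow> 'e set \<Rightarrow> ('e \<Rightarrow> 'v) \<Rightarrow> ('e \<Rightarrow> 'v) \<Rightarrow> 'e set \<Rightarrow> bool" where
  "spanning_tree V E s t T \<longleftrightarrow>
     T \<subseteq> E \<and> graph_connected V T s t \<and> \<not> (\<exists>es vs. is_cycle T s t es vs)"

text \<open>The group K = (Z_m)^r, with coordinates indexed by the non-tree edges E - T;
  elements are functions with values in {0..<m} vanishing outside E - T.\<close>
definition cover_group :: "'e set \<Rightarrow> 'e set \<Rightarrow> nat \<Rightarrow> ('e \<Rightarrow> nat) set" where
  "cover_group E T m = {k. (\<forall>e. k e < m) \<and> (\<forall>e. e \<notin> E - T \<longrightarrow> k e = 0)}"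

text \<open>Translation by rho(e), the basis vector of the non-tree edge e.\<close>
definition rho_shift :: "nat \<Rightarrow> 'e \<Rightarrow> ('e \<Rightarrow> nat) \<Rightarrow> ('e \<Rightarrow> nat)" where
  "rho_shift m e k = k(e := (k e + 1) mod m)"

definition cover_vertices :: "'v set \<Rightarrow> 'e set \<Rightarrow> 'e set \<Rightarrow> nat \<Rightarrow> ('v \<times> ('e \<Rightarrow> nat)) set" where
  "cover_vertices V E T m = V \<times> cover_group E T m"

text \<open>Edges of the Z_m-homology cover (w.r.t. the spanning tree T), as a directed relation:
  edge (e,k) joins (s e, k) with (t e, k) if e \<in> T and with (t e, rho(e) k) otherwise.\<close>
definition cover_edges :: "'e set \<Rightarrow> ('e \<Rightarrow> 'v) \<Rightarrow> ('e \<Rightarrow> 'v) \<Rightarrow> 'e set \<Rightarrow> nat \<Rightarrow>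
    (('v \<times> ('e \<Rightarrow> nat)) \<times> ('v \<times> ('e \<Rightarrow> nat))) set" where
  "cover_edges E s t T m =
     {((s e, k), (t e, if e \<in> T then k else rho_shift m e k)) | e k. e \<in> E \<and> k \<in> cover_group E T m}"

text \<open>Graph metric: length of a shortest path along the (symmetrised) edge relation.\<close>
definition graph_dist :: "('a \<times> 'a) set \<Rightarrow> 'a \<Rightarrow> 'a \<Rightarrow> real" where
  "graph_dist R x y = real (LEAST n. (x, y) \<in> (R \<union> R\<inverse>) ^^ n)"

definition cover_dist :: "'e set \<Rightarrow> ('e \<Rightarrow> 'v) \<Rightarrow> ('e \<Rightarrow> 'v) \<Rightarrow> 'e set \<Rightarrow> nat \<Rightarrow>
    ('v \<times> ('e \<Rightarrow> nat)) \<Rightarrow> ('v \<times> ('e \<Rightarrow> nat)) \<Rightarrow> real" where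
  "cover_dist E s t T m = graph_dist (cover_edges E s t T m)"

text \<open>D is a metric on the disjoint union of the spaces (Xs n, ds n) realising the coarse
  disjoint union: restricts to ds n on each piece, distances between distinct pieces exceed
  both diameters and tend to infinity.\<close>
definition coarse_disjoint_union_metric ::
    "(nat \<Rightarrow> 'p set) \<Rightarrow> (nat \<Rightarrow> 'p \<Rightarrow> 'p \<Rightarrow> real) \<Rightarrow> ((nat \<times> 'p) \<Rightarrow> (nat \<times> 'p) \<Rightarrow> real) \<Rightarrow> bool" where
  "coarse_disjoint_union_metric Xs ds D \<longleftrightarrow>
     (\<forall>p\<in>Sigma UNIV Xs. \<forall>q\<in>Sigma UNIV Xs. 0 \<le> D p q \<and> (D p q = 0 \<longleftrightarrow> p = q) \<and> D p q = D q p \<and>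
        (\<forall>r\<in>Sigma UNIV Xs. D p r \<le> D p q + D q r)) \<and>
     (\<forall>n x y. x \<in> Xs n \<and> y \<in> Xs n \<longrightarrow> D (n, x) (n, y) = ds n x y) \<and>
     (\<forall>n n' x y. n \<noteq> n' \<and> x \<in> Xs n \<and> y \<in> Xs n' \<longrightarrow>
        (\<forall>a\<in>Xs n. \<forall>b\<in>Xs n. ds n a b < D (n, x) (n', y)) \<and>
        (\<forall>a\<in>Xs n'. \<forall>b\<in>Xs n'. ds n' a b < D (n, x) (n', y))) \<and>
     (\<forall>R. \<exists>N. \<forall>n n' x y. n \<noteq> n' \<and> N \<le> max n n' \<and> x \<in> Xs n \<and> y \<in> Xs n' \<longrightarrow> R \<le> D (n, x) (n', y))"

text \<open>Hilbert space l^2(N): square-summable real sequences, with its norm distance.\<close>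
definition l2_dist :: "(nat \<Rightarrow> real) \<Rightarrow> (nat \<Rightarrow> real) \<Rightarrow> real" where
  "l2_dist f g = sqrt (\<Sum>i. (f i - g i)\<^sup>2)"

definition coarsely_embeds_into_l2 :: "'p set \<Rightarrow> ('p \<Rightarrow> 'p \<Rightarrow> real) \<Rightarrow> bool" where
  "coarsely_embeds_into_l2 U D \<longleftrightarrow>
     (\<exists>F :: 'p \<Rightarrow> nat \<Rightarrow> real. \<exists>rm rp :: real \<Rightarrow> real.
        (\<forall>p\<in>U. summable (\<lambda>i. (F p i)\<^sup>2)) \<and>
        (\<forall>x\<ge>0. 0 \<le> rm x \<and> 0 \<le> rp x) \<and>
        mono_on {0..} rm \<and> mono_on {0..} rp \<and>
        filterlim rm at_top at_top \<and> filterlim rp at_top at_top \<and>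
        (\<forall>p\<in>U. \<forall>q\<in>U. rm (D p q) \<le> l2_dist (F p) (F q) \<and> l2_dist (F p) (F q) \<le> rp (D p q)))"

end

theory Submission
  imports Defs
begin

text \<open>Record, for every edge e of the base graph, how often (with sign, modulo m) a path of the
  cover from a base point to x crosses e. This is well defined, because a closed path of the cover
  projects to a cycle that is zero modulo m; so each vertex x of the cover gets a label in the
  group of 1-chains modulo m, and adjacent vertices have labels that differ in one coordinate. Hence
  the Hamming distance h of labels is at most the graph distance d. Conversely, the difference of
  two labels is a chain whose boundary is the difference of the two projected vertices. If
  h is less than the girth, the support of this chain is a forest; every leaf of it
  carries boundary and is thus one of these two vertices, so the support is a path, whose lift
  shows that d is at most h. Therefore h lies between min(d, girth) and d. Up to constants depending
  on m, h is the square of a Euclidean distance, and the components are kept apart by one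
  further coordinate with value n^2 on the n-th one.\<close>

section \<open>Leaves of forests\<close>

definition joins :: "('e \<Rightarrow> 'v) \<Rightarrow> ('e \<Rightarrow> 'v) \<Rightarrow> 'e \<Rightarrow> 'v \<Rightarrow> 'v \<Rightarrow> bool" where
  "joins s t e u v \<longleftrightarrow> (s e = u \<and> t e = v) \<or> (t e = u \<and> s e = v)"

text \<open>Simple paths. Only the vertices are required to be distinct, because distinctness of the
  edges follows.\<close>

definition edge_path :: "'e set \<Rightarrow> ('e \<Rightarrow> 'v) \<Rightarrow> ('e \<Rightarrow> 'v) \<Rightarrow> 'e list \<Rightarrow> 'v list \<Rightarrow> bool" where
  "edge_path S s t es vs \<longleftrightarrow>
     length vs = Suc (length es) \<and> distinct vs \<and> set es \<subseteq> S \<and>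
     (\<forall>i<length es. joins s t (es ! i) (vs ! i) (vs ! Suc i))"

text \<open>An edge determines its two endpoints, so using it at positions \<open>i < j\<close>
  would make \<open>vs ! i\<close> reappear at position \<open>j\<close> or
  \<open>Suc j\<close>.\<close>

lemma edge_path_distinct_edges:
  assumes "edge_path S s t es vs"
  shows "distinct es"
proof -
  have False if ij: "i < j" "j < length es" "es ! i = es ! j" for i j
  proof -
    have J: "joins s t (es ! i) (vs ! i) (vs ! Suc i)" if "i < length es" for i
      using assms that by (auto simp: edge_path_def)
    have "joins s t (es ! i) (vs ! i) (vs ! Suc i)" "joins s t (es ! i) (vs ! j) (vs ! Suc j)"
      using J[of i] J[of j] ij by simp_all
    then have "vs ! i = vs ! j \<or> vs ! i = vs ! Suc j"
      by (auto simp: joins_def)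
    then show False
      using assms ij by (auto simp: edge_path_def nth_eq_iff_index_eq)
  qed
  then show ?thesis
    unfolding distinct_conv_nth by (metis nat_neq_iff)
qed

text \<open>The returning edge closes up the initial segment ending at \<open>vs ! j\<close>; for
  \<open>j = 0\<close> it is a loop. Only the first edge has to be excluded: later edges of a simple
  path avoid \<open>vs ! 0\<close>, whereas running back along the first edge would give no
  cycle.\<close>

lemma edge_path_closing_edge_cycle:
  assumes p: "edge_path S s t es vs" and j: "j < length vs"
    and e: "e \<in> S" "joins s t e (vs ! j) (vs ! 0)" and ne: "es \<noteq> [] \<Longrightarrow> e \<noteq> es ! 0"
  shows "is_cycle S s t (take j es @ [e]) (take (Suc j) vs)"
proof -
  have len: "length (take j es @ [e]) = Suc j" "length (take (Suc j) vs) = Suc j"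
    using p j by (auto simp: edge_path_def)
  have "e \<notin> set (take j es)"
  proof
    assume "e \<in> set (take j es)"
    then obtain i where i: "i < j" "i < length es" "es ! i = e"
      by (auto simp: in_set_conv_nth)
    then have "es \<noteq> []" by auto
    then have "i \<noteq> 0" using ne i by metis
    moreover have "joins s t e (vs ! i) (vs ! Suc i)"
      using p i by (auto simp: edge_path_def)
    then have "vs ! 0 = vs ! i \<or> vs ! 0 = vs ! Suc i"
      using e by (auto simp: joins_def)
    ultimately show False
      using p i by (auto simp: edge_path_def nth_eq_iff_index_eq)
  qed
  then have "distinct (take j es @ [e])"
    using edge_path_distinct_edges[OF p] by auto
  moreover have "distinct (take (Suc j) vs)"
    using p by (auto simp: edge_path_def)
  moreover have "set (take j es @ [e]) \<subseteq> S"
    using p e set_take_subset[of j es] by (auto simp: edge_path_def)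
  moreover have "joins s t ((take j es @ [e]) ! i) (take (Suc j) vs ! i)
      (take (Suc j) vs ! ((i + 1) mod Suc j))" if i: "i < Suc j" for i
  proof (cases "i = j")
    case True
    then show ?thesis using e len by (auto simp: nth_append)
  next
    case False
    then show ?thesis using p i j by (auto simp: nth_append edge_path_def)
  qed
  ultimately show ?thesis
    unfolding is_cycle_def len joins_def[symmetric] by auto
qed

text \<open>The starting vertex of a longest simple path is a leaf: a second edge there either
  returns to the path and closes a cycle, or leads to a new vertex and prolongs the path.\<close>

lemma acyclic_has_leaf:
  assumes fin: "finite S" and ne: "S \<noteq> {}" and acyc: "\<not> (\<exists>es vs. is_cycle S s t es vs)"
  obtains w e where "e \<in> S" "s e \<noteq> t e" "w = s e \<or> w = t e"
    "\<And>f. f \<in> S \<Longrightarrow> s f = w \<or> t f = w \<Longrightarrow> f = e"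
proof -
  define L where "L = {n. \<exists>es vs. es \<noteq> [] \<and> edge_path S s t es vs \<and> length es = n}"
  have loop: "s f \<noteq> t f" if "f \<in> S" for f
  proof
    assume "s f = t f"
    then have "is_cycle S s t [f] [s f]" using that by (auto simp: is_cycle_def)
    then show False using acyc by blast
  qed
  have "n \<le> card S" if n: "n \<in> L" for n
  proof -
    obtain es vs where "edge_path S s t es vs" "length es = n"
      using n unfolding L_def by blast
    then show ?thesis
      using edge_path_distinct_edges[of S s t es vs] fin
      by (metis card_mono distinct_card edge_path_def)
  qed
  then have finL: "finite L"
    by (meson finite_nat_set_iff_bounded_le)
  obtain e0 where e0: "e0 \<in> S" using ne by auto
  have "edge_path S s t [e0] [s e0, t e0]"
    using loop[OF e0] e0 by (auto simp: edge_path_def joins_def)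
  then have "1 \<in> L" by (force simp: L_def)
  then have "Max L \<in> L" using finL by (auto intro: Max_in)
  then obtain es vs where p: "edge_path S s t es vs" "es \<noteq> []" "length es = Max L"
    by (auto simp: L_def)
  have j0: "joins s t (es ! 0) (vs ! 0) (vs ! Suc 0)" and e0S: "es ! 0 \<in> S"
    using p(1,2) unfolding edge_path_def by (cases es; force)+
  show thesis
  proof (rule that[of "es ! 0" "vs ! 0"])
    show "es ! 0 \<in> S" by fact
    then show "s (es ! 0) \<noteq> t (es ! 0)" by (rule loop)
    show "vs ! 0 = s (es ! 0) \<or> vs ! 0 = t (es ! 0)"
      using j0 by (auto simp: joins_def)
    fix f assume f: "f \<in> S" "s f = vs ! 0 \<or> t f = vs ! 0"
    then obtain u where u: "joins s t f u (vs ! 0)" by (auto simp: joins_def)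
    show "f = es ! 0"
    proof (rule ccontr)
      assume neq: "f \<noteq> es ! 0"
      show False
      proof (cases "u \<in> set vs")
        case True
        then obtain j where "j < length vs" "vs ! j = u" by (auto simp: in_set_conv_nth)
        then show False
          using edge_path_closing_edge_cycle[OF p(1), of j f] f u neq acyc by blast
      next
        case False
        have "edge_path S s t (f # es) (u # vs)"
          using p(1) False u f unfolding edge_path_def
          by (auto simp: nth_Cons split: nat.splits)
        then have "Suc (Max L) \<in> L" using p(3) unfolding L_def by force
        then show False using finL Max_ge not_less_eq_eq by blast
      qed
    qed
  qed
qed

section \<open>Boundaries of chains modulo m\<close>

text \<open>The simplicial boundary of an integral 1-chain, evaluated at a vertex; loops contribute
  zero. Reduction modulo \<open>M\<close> is expressed by divisibility, so \<open>M = 0\<close>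
  covers integral identities.\<close>

definition bdry :: "'e set \<Rightarrow> ('e \<Rightarrow> 'v) \<Rightarrow> ('e \<Rightarrow> 'v) \<Rightarrow> ('e \<Rightarrow> int) \<Rightarrow> 'v \<Rightarrow> int" where
  "bdry E s t c w = (\<Sum>e\<in>E. c e * (of_bool (t e = w) - of_bool (s e = w)))"

lemma bdry_add: "bdry E s t (\<lambda>e. c e + d e) w = bdry E s t c w + bdry E s t d w"
  by (simp add: bdry_def sum.distrib distrib_right)

lemma bdry_diff: "bdry E s t (\<lambda>e. c e - d e) w = bdry E s t c w - bdry E s t d w"
  by (simp add: bdry_def sum_subtractf left_diff_distrib)

lemma bdry_scale: "bdry E s t (\<lambda>e. a * c e) w = a * bdry E s t c w"
  by (simp add: bdry_def sum_distrib_left mult.assoc)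

lemma bdry_sum: "bdry E s t (\<lambda>e. \<Sum>i\<in>I. c i e) w = (\<Sum>i\<in>I. bdry E s t (c i) w)"
  unfolding bdry_def sum_distrib_right by (rule sum.swap)

lemma bdry_edge:
  assumes "finite E" "e \<in> E"
  shows "bdry E s t (\<lambda>f. of_bool (f = e)) w = of_bool (w = t e) - of_bool (w = s e)"
  using assms by (auto simp: bdry_def of_bool_def if_distrib[of "\<lambda>x. x * _"] sum.delta cong: if_cong)

text \<open>Every edge at \<open>w\<close> other than \<open>e\<close> has a coefficient divisible
  by \<open>M\<close>, so only \<open>e\<close> contributes to the boundary there.\<close>

lemma bdry_at_leaf:
  fixes M :: int
  assumes "finite E" and S: "S = {e \<in> E. \<not> M dvd c e}" and "e \<in> S"
    and leaf: "\<And>f. f \<in> S \<Longrightarrow> s f = w \<or> t f = w \<Longrightarrow> f = e"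
  shows "M dvd bdry E s t c w - c e * (of_bool (t e = w) - of_bool (s e = w))"
proof -
  have "e \<in> E" using \<open>e \<in> S\<close> S by simp
  then have "bdry E s t c w - c e * (of_bool (t e = w) - of_bool (s e = w))
      = (\<Sum>f\<in>E - {e}. c f * (of_bool (t f = w) - of_bool (s f = w)))"
    using sum.remove[OF \<open>finite E\<close>, of e "\<lambda>f. c f * (of_bool (t f = w) - of_bool (s f = w))"]
    by (simp add: bdry_def)
  moreover have "M dvd c f * (of_bool (t f = w) - of_bool (s f = w))" if f: "f \<in> E - {e}" for f
  proof (cases "M dvd c f")
    case False
    then have "f \<in> S" using f S by auto
    then have "s f \<noteq> w \<and> t f \<noteq> w" using leaf f by blast
    then show ?thesis by auto
  qed auto
  ultimately show ?thesis by (auto intro: dvd_sum)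
qed

text \<open>If the support were nonempty, it would have a leaf, where the boundary is plus or minus
  one coefficient of the support and hence nonzero modulo \<open>M\<close>.\<close>

lemma acyclic_closed_chain_zero:
  fixes M :: int
  assumes fin: "finite E" and acyc: "\<not> (\<exists>es vs. is_cycle {e \<in> E. \<not> M dvd c e} s t es vs)"
    and closed: "\<And>w. M dvd bdry E s t c w" and "e \<in> E"
  shows "M dvd c e"
proof (rule ccontr)
  assume "\<not> M dvd c e"
  define S where "S = {e \<in> E. \<not> M dvd c e}"
  have S: "finite S" "S \<noteq> {}"
    using fin \<open>e \<in> E\<close> \<open>\<not> M dvd c e\<close> by (auto simp: S_def)
  obtain w e where we: "e \<in> S" "s e \<noteq> t e" "w = s e \<or> w = t e"
    "\<And>f. f \<in> S \<Longrightarrow> s f = w \<or> t f = w \<Longrightarrow> f = e"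
    using acyclic_has_leaf[OF S acyc[folded S_def]] by metis
  have "M dvd bdry E s t c w - c e * (of_bool (t e = w) - of_bool (s e = w))"
    by (rule bdry_at_leaf[OF fin S_def we(1)]) (use we(4) in blast)
  then have "M dvd c e * (of_bool (t e = w) - of_bool (s e = w))"
    using dvd_diff[OF closed[of w]] by fastforce
  then show False using we(1-3) by (auto simp: S_def)
qed

lemma is_cycle_mono: "is_cycle S s t es vs \<Longrightarrow> S \<subseteq> S' \<Longrightarrow> is_cycle S' s t es vs"
  by (auto simp: is_cycle_def)

section \<open>The chain labelling of the homology cover\<close>

text \<open>The label is the 1-chain traced by a path from a base point over \<open>v0\<close>. The
  first clause holds only modulo \<open>m\<close>, because \<open>rho_shift\<close> wraps around.
  The other two recover the vertex and the group element from the label.\<close>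

definition chain_labelling :: "'v set \<Rightarrow> 'e set \<Rightarrow> ('e \<Rightarrow> 'v) \<Rightarrow> ('e \<Rightarrow> 'v) \<Rightarrow> 'e set \<Rightarrow> nat \<Rightarrow>
    ('v \<times> ('e \<Rightarrow> nat) \<Rightarrow> 'e \<Rightarrow> int) \<Rightarrow> bool" where
  "chain_labelling V E s t T m \<Phi> \<longleftrightarrow>
     (\<forall>e\<in>E. \<forall>k\<in>cover_group E T m. \<forall>f\<in>E.
        int m dvd \<Phi> (t e, if e \<in> T then k else rho_shift m e k) f - \<Phi> (s e, k) f - of_bool (f = e)) \<and>
     (\<exists>v0. \<forall>x\<in>cover_vertices V E T m. \<forall>w.
        bdry E s t (\<Phi> x) w = of_bool (w = fst x) - of_bool (w = v0)) \<and>
     (\<forall>x\<in>cover_vertices V E T m. \<forall>e\<in>E - T. \<Phi> x e = int (snd x e))"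

text \<open>\<open>P\<close> is the signed count of the edges on a path in \<open>T\<close>: an edge
  is added or subtracted according to the direction in which it is crossed.\<close>

lemma tree_path_chain:
  assumes "finite E" "T \<subseteq> E" "(v0, v) \<in> (adj_rel T s t)\<^sup>*"
  shows "\<exists>P. (\<forall>e. e \<notin> T \<longrightarrow> P e = 0) \<and>
    (\<forall>w. bdry E s t P w = of_bool (w = v) - of_bool (w = v0))"
  using assms(3)
proof (induction rule: rtrancl_induct)
  case base
  show ?case by (rule exI[of _ "\<lambda>_. 0"]) (simp add: bdry_def)
next
  case (step u v)
  then obtain P where P: "\<forall>e. e \<notin> T \<longrightarrow> P e = 0"
    "\<forall>w. bdry E s t P w = of_bool (w = u) - of_bool (w = v0)" by blast
  from step obtain e where e: "e \<in> T" "(s e = u \<and> t e = v) \<or> (t e = u \<and> s e = v)"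
    by (auto simp: adj_rel_def)
  then have eE: "e \<in> E" using assms by auto
  from e(2) show ?case
  proof
    assume "s e = u \<and> t e = v"
    then show ?thesis
      using P e by (intro exI[of _ "\<lambda>f. P f + of_bool (f = e)"])
        (auto simp: bdry_add bdry_edge[OF assms(1) eE])
  next
    assume "t e = u \<and> s e = v"
    then show ?thesis
      using P e by (intro exI[of _ "\<lambda>f. P f - of_bool (f = e)"])
        (auto simp: bdry_diff bdry_edge[OF assms(1) eE])
  qed
qed

section \<open>Existence of the chain labelling\<close>

locale homology_cover =
  fixes V :: "'v set" and E :: "'e set" and s t :: "'e \<Rightarrow> 'v" and T :: "'e set" and m :: nat
  assumes graph: "finite_graph V E s t" and tree: "spanning_tree V E s t T" and m2: "2 \<le> m"
begin

abbreviation "KG \<equiv> cover_group E T m"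
abbreviation "CV \<equiv> cover_vertices V E T m"
abbreviation "Adj \<equiv> cover_edges E s t T m \<union> (cover_edges E s t T m)\<inverse>"

lemma finE: "finite E" and TE: "T \<subseteq> E"
  and endpoints: "e \<in> E \<Longrightarrow> s e \<in> V" "e \<in> E \<Longrightarrow> t e \<in> V"
  using graph tree by (auto simp: finite_graph_def spanning_tree_def)

lemma rho_shift_in_group: "k \<in> KG \<Longrightarrow> e \<in> E - T \<Longrightarrow> rho_shift m e k \<in> KG"
  using m2 by (auto simp: cover_group_def rho_shift_def)

text \<open>Adding \<open>m - 1\<close> inverts the shift modulo \<open>m\<close>. This is needed to
  cross a non-tree edge against its orientation.\<close>

lemma rho_shift_surj:
  assumes "k \<in> KG" "e \<in> E - T"
  obtains k' where "k' \<in> KG" "rho_shift m e k' = k"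
proof
  let ?k' = "k(e := (k e + (m - 1)) mod m)"
  show "?k' \<in> KG" using assms m2 by (auto simp: cover_group_def)
  have "((k e + (m - 1)) mod m + 1) mod m = k e"
    using assms m2 by (simp add: mod_Suc_eq cover_group_def)
  then show "rho_shift m e ?k' = k" by (auto simp: rho_shift_def)
qed

lemma finite_CV: "finite CV"
proof -
  have "KG \<subseteq> {k. \<forall>e. (e \<in> E - T \<longrightarrow> k e \<in> {..<m}) \<and> (e \<notin> E - T \<longrightarrow> k e = 0)}"
    by (auto simp: cover_group_def)
  then have "finite KG"
    using finite_set_of_finite_funs[of "E - T" "{..<m}" 0] finE finite_subset by blast
  then show ?thesis
    using graph by (auto simp: cover_vertices_def finite_graph_def)
qed

text \<open>The label of \<open>(v, k)\<close> is the chain of a tree path to \<open>v\<close> plus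
  the combination, with coefficients \<open>k\<close>, of the fundamental cycles of the non-tree
  edges.\<close>

lemma chain_labelling_exists: "\<exists>\<Phi>. chain_labelling V E s t T m \<Phi>"
proof (cases "V = {}")
  case True
  then have "E = {}" using endpoints by auto
  then show ?thesis using True by (auto simp: chain_labelling_def cover_vertices_def)
next
  case False
  then obtain v0 where v0: "v0 \<in> V" by auto
  have "\<forall>v\<in>V. \<exists>P. (\<forall>e. e \<notin> T \<longrightarrow> P e = 0) \<and>
      (\<forall>w. bdry E s t P w = of_bool (w = v) - of_bool (w = v0))"
  proof
    fix v assume "v \<in> V"
    then have "(v0, v) \<in> (adj_rel T s t)\<^sup>*"
      using v0 tree by (auto simp: spanning_tree_def graph_connected_def)
    then show "\<exists>P. (\<forall>e. e \<notin> T \<longrightarrow> P e = 0) \<and>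
        (\<forall>w. bdry E s t P w = of_bool (w = v) - of_bool (w = v0))"
      by (rule tree_path_chain[OF finE TE])
  qed
  then obtain P where PT: "\<And>v e. v \<in> V \<Longrightarrow> e \<notin> T \<Longrightarrow> P v e = 0"
    and Pb: "\<And>v w. v \<in> V \<Longrightarrow> bdry E s t (P v) w = of_bool (w = v) - of_bool (w = v0)"
    by (metis (no_types, lifting))
  \<comment> \<open>The fundamental cycle of \<open>e\<close>: the tree path to its source, then
    \<open>e\<close>, then the tree path back from its target.\<close>
  define Z where "Z e f = of_bool (f = e) + P (s e) f - P (t e) f" for e f
  define \<Phi> where "\<Phi> x f = P (fst x) f + (\<Sum>e\<in>E - T. int (snd x e) * Z e f)" for x f
  have Zb: "bdry E s t (Z e) w = 0" if "e \<in> E" for e w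
    unfolding Z_def by (simp add: bdry_add bdry_diff bdry_edge[OF finE that] Pb endpoints that)
  \<comment> \<open>For a tree edge this closed chain lives on the forest \<open>T\<close>, so it
    vanishes over the integers. The modulus \<open>0\<close> is used, for which divisibility means
    equality to zero.\<close>
  have Z0: "Z e f = 0" if "e \<in> T" "f \<in> E" for e f
  proof -
    have e: "e \<in> E" using that TE by auto
    have "Z e f = 0" if "f \<notin> T" for f
      using that \<open>e \<in> T\<close> by (auto simp: Z_def PT endpoints e)
    then have "{f \<in> E. \<not> 0 dvd Z e f} \<subseteq> T" by auto
    then have "\<not> (\<exists>es vs. is_cycle {f \<in> E. \<not> 0 dvd Z e f} s t es vs)"
      using tree is_cycle_mono unfolding spanning_tree_def by metis
    then have "0 dvd Z e f"
      by (rule acyclic_closed_chain_zero[OF finE]) (use Zb e that in auto)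
    then show ?thesis by simp
  qed
  have "int m dvd \<Phi> (t e, if e \<in> T then k else rho_shift m e k) f - \<Phi> (s e, k) f - of_bool (f = e)"
    if e: "e \<in> E" and k: "k \<in> KG" and f: "f \<in> E" for e k f
  proof (cases "e \<in> T")
    case True
    then have "\<Phi> (t e, if e \<in> T then k else rho_shift m e k) f - \<Phi> (s e, k) f - of_bool (f = e)
        = - Z e f"
      by (simp add: \<Phi>_def Z_def)
    then show ?thesis using Z0[OF True f] by simp
  next
    case False
    let ?k = "rho_shift m e k"
    have "(\<Sum>g\<in>E - T. int (?k g) * Z g f) - (\<Sum>g\<in>E - T. int (k g) * Z g f)
        = (int (?k e) - int (k e)) * Z e f"
    proof -
      have "(\<Sum>g\<in>E - T. int (?k g) * Z g f) - (\<Sum>g\<in>E - T. int (k g) * Z g f)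
        = (\<Sum>g\<in>E - T. if g = e then (int (?k e) - int (k e)) * Z e f else 0)"
        unfolding sum_subtractf[symmetric]
        by (rule sum.cong) (auto simp: rho_shift_def algebra_simps)
      then show ?thesis using finE e False by (simp add: sum.delta)
    qed
    then have "\<Phi> (t e, ?k) f - \<Phi> (s e, k) f - of_bool (f = e)
        = (int (?k e) - int (k e) - 1) * Z e f"
      by (simp add: \<Phi>_def Z_def algebra_simps)
    \<comment> \<open>The shift raises the coordinate by one up to wrap-around; this is the only
      place where the labels agree merely modulo \<open>m\<close>.\<close>
    moreover have "int m dvd int (?k e) - int (k e) - 1"
      by (simp add: rho_shift_def zmod_int mod_eq_dvd_iff[symmetric] diff_diff_eq add.commute)
    ultimately show ?thesis using False by simp
  qed
  moreover have "bdry E s t (\<Phi> x) w = of_bool (w = fst x) - of_bool (w = v0)" if "x \<in> CV" for x w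
  proof -
    have "fst x \<in> V" using that by (auto simp: cover_vertices_def)
    then show ?thesis
      unfolding \<Phi>_def by (simp add: bdry_add bdry_sum bdry_scale Zb Pb)
  qed
  moreover have "\<Phi> x e = int (snd x e)" if "x \<in> CV" "e \<in> E - T" for x e
  proof -
    have "fst x \<in> V" using that by (auto simp: cover_vertices_def)
    \<comment> \<open>A non-tree edge lies on its own fundamental cycle only, with coefficient one,
      and on no tree path.\<close>
    moreover have "(\<Sum>g\<in>E - T. int (snd x g) * Z g e) = (\<Sum>g\<in>E - T. if g = e then int (snd x e) else 0)"
      by (rule sum.cong) (use that in \<open>auto simp: Z_def PT endpoints\<close>)
    ultimately show ?thesis using that finE by (simp add: \<Phi>_def PT sum.delta)
  qed
  ultimately show ?thesis unfolding chain_labelling_def by blast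
qed

section \<open>Connectedness of the cover\<close>

lemma Adj_sym: "(x, y) \<in> Adj \<longleftrightarrow> (y, x) \<in> Adj"
  by auto

lemma cover_edge:
  "e \<in> E \<Longrightarrow> k \<in> KG \<Longrightarrow> ((s e, k), (t e, if e \<in> T then k else rho_shift m e k)) \<in> cover_edges E s t T m"
  unfolding cover_edges_def by blast

lemma Adj_in_CV: "(x, y) \<in> Adj \<Longrightarrow> x \<in> CV \<and> y \<in> CV"
  by (auto simp: cover_edges_def cover_vertices_def endpoints rho_shift_in_group)

text \<open>Lifts of tree edges connect the points with a fixed group element. Going to the source
  of a non-tree edge, crossing it and returning changes one coordinate by one, so all coordinates
  can be adjusted one after another.\<close>

lemma cover_connected:
  assumes "x \<in> CV" "y \<in> CV"
  shows "(x, y) \<in> Adj\<^sup>*"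
proof -
  have tree_move: "((u, k), (v, k)) \<in> Adj\<^sup>*" if k: "k \<in> KG" and uv: "u \<in> V" "v \<in> V" for u v k
  proof -
    have "(u, v) \<in> (adj_rel T s t)\<^sup>*"
      using tree uv by (auto simp: spanning_tree_def graph_connected_def)
    then show ?thesis
    proof (induction rule: rtrancl_induct)
      case (step v w)
      then obtain e where e: "e \<in> T" "(s e = v \<and> t e = w) \<or> (t e = v \<and> s e = w)"
        by (auto simp: adj_rel_def)
      have "((s e, k), (t e, k)) \<in> cover_edges E s t T m"
        using cover_edge[of e k] e k TE by auto
      then have "((v, k), (w, k)) \<in> Adj" using e by auto
      with step show ?case by (meson rtrancl.rtrancl_into_rtrancl)
    qed auto
  qed
  have shift_move: "((u, k), (u, rho_shift m e k)) \<in> Adj\<^sup>*"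
    if k: "k \<in> KG" and u: "u \<in> V" and e: "e \<in> E - T" for u k e
  proof -
    have "((s e, k), (t e, rho_shift m e k)) \<in> Adj" using cover_edge[of e k] e k by auto
    moreover have "((u, k), (s e, k)) \<in> Adj\<^sup>*" using tree_move k u e endpoints by auto
    moreover have "((t e, rho_shift m e k), (u, rho_shift m e k)) \<in> Adj\<^sup>*"
      using tree_move rho_shift_in_group k u e endpoints by auto
    ultimately show ?thesis by (meson rtrancl.rtrancl_into_rtrancl rtrancl_trans)
  qed
  have iterate_move: "((u, k), (u, k(e := (k e + j) mod m))) \<in> Adj\<^sup>*"
    if k: "k \<in> KG" and u: "u \<in> V" and e: "e \<in> E - T" for u k e j
  proof (induction j)
    case 0
    then show ?case using k by (auto simp: cover_group_def)
  next
    case (Suc j)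
    let ?k = "k(e := (k e + j) mod m)"
    have "?k \<in> KG" using k e m2 by (auto simp: cover_group_def)
    moreover have "rho_shift m e ?k = k(e := (k e + Suc j) mod m)"
      by (auto simp: rho_shift_def mod_Suc_eq)
    ultimately have "((u, ?k), (u, k(e := (k e + Suc j) mod m))) \<in> Adj\<^sup>*"
      using shift_move[of ?k u e] u e by simp
    with Suc show ?case by (rule rtrancl_trans)
  qed
  obtain u k v l where xy: "x = (u, k)" "y = (v, l)" "u \<in> V" "v \<in> V" "k \<in> KG" "l \<in> KG"
    using assms by (auto simp: cover_vertices_def)
  have "((u, k), (u, \<lambda>e. if e \<in> F then l e else k e)) \<in> Adj\<^sup>*" if "F \<subseteq> E - T" for F
    using finite_subset[OF that finite_Diff[OF finE]] that
  proof (induction F rule: finite_induct)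
    case (insert e F)
    let ?k = "\<lambda>e. if e \<in> F then l e else k e"
    have "?k \<in> KG" using xy by (auto simp: cover_group_def)
    \<comment> \<open>The number of shifts \<open>m - k e + l e\<close> is a natural number
      congruent to \<open>l e - k e\<close> modulo \<open>m\<close>.\<close>
    then have "((u, ?k), (u, ?k(e := (?k e + (m - k e + l e)) mod m))) \<in> Adj\<^sup>*"
      by (rule iterate_move) (use insert xy in auto)
    moreover have "?k(e := (?k e + (m - k e + l e)) mod m) = (\<lambda>f. if f \<in> insert e F then l f else k f)"
    proof -
      have "k e < m" "l e < m" using xy by (auto simp: cover_group_def)
      then have "(k e + (m - k e + l e)) mod m = l e" by simp
      then show ?thesis using insert by auto
    qed
    ultimately have "((u, ?k), (u, \<lambda>f. if f \<in> insert e F then l f else k f)) \<in> Adj\<^sup>*"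
      by simp
    with insert show ?case by (blast intro: rtrancl_trans)
  qed simp
  from this[of "E - T"] have "((u, k), (u, \<lambda>e. if e \<in> E - T then l e else k e)) \<in> Adj\<^sup>*" by auto
  moreover have "(\<lambda>e. if e \<in> E - T then l e else k e) = l"
    using xy by (auto simp: cover_group_def)
  ultimately have "((u, k), (u, l)) \<in> Adj\<^sup>*" by simp
  also have "((u, l), (v, l)) \<in> Adj\<^sup>*" by (rule tree_move) (use xy in auto)
  finally show ?thesis using xy by simp
qed

section \<open>Hamming distance of labels versus graph distance\<close>

context
  fixes \<Phi>
  assumes lab: "chain_labelling V E s t T m \<Phi>"
begin

text \<open>The support modulo \<open>m\<close> of the difference chain; its cardinality is the
  Hamming distance of the labels.\<close>

definition disagree where "disagree x y = {e \<in> E. \<not> int m dvd \<Phi> y e - \<Phi> x e}"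

lemma finite_disagree: "finite (disagree x y)"
  using finE by (auto simp: disagree_def)

lemma edge_label:
  "e \<in> E \<Longrightarrow> k \<in> KG \<Longrightarrow> f \<in> E \<Longrightarrow>
    int m dvd \<Phi> (t e, if e \<in> T then k else rho_shift m e k) f - \<Phi> (s e, k) f - of_bool (f = e)"
  using lab by (auto simp: chain_labelling_def)

lemma disagree_Adj:
  assumes "(x, y) \<in> Adj"
  shows "\<exists>e. disagree x y \<subseteq> {e}"
proof -
  obtain e k where ek: "e \<in> E" "k \<in> KG"
    "(x = (s e, k) \<and> y = (t e, if e \<in> T then k else rho_shift m e k)) \<or>
     (y = (s e, k) \<and> x = (t e, if e \<in> T then k else rho_shift m e k))"
    using assms unfolding cover_edges_def by blast
  have "int m dvd \<Phi> y f - \<Phi> x f" if "f \<in> E" "f \<noteq> e" for f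
    using edge_label[OF ek(1,2) that(1)] ek(3) that(2) by (auto simp: dvd_diff_commute)
  then show ?thesis by (auto simp: disagree_def)
qed

lemma disagree_triangle: "disagree x z \<subseteq> disagree x y \<union> disagree y z"
proof
  fix e assume e: "e \<in> disagree x z"
  show "e \<in> disagree x y \<union> disagree y z"
  proof (rule ccontr)
    assume "\<not> ?thesis"
    then have "int m dvd (\<Phi> z e - \<Phi> y e) + (\<Phi> y e - \<Phi> x e)"
      using e by (intro dvd_add) (auto simp: disagree_def)
    then show False using e by (simp add: disagree_def)
  qed
qed

text \<open>Each step of a path in the cover changes at most one coordinate modulo
  \<open>m\<close>.\<close>

lemma card_disagree_relpow: "(x, y) \<in> Adj ^^ n \<Longrightarrow> card (disagree x y) \<le> n"
proof (induction n arbitrary: y)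
  case 0
  then show ?case by (auto simp: disagree_def)
next
  case (Suc n)
  then obtain z where z: "(x, z) \<in> Adj ^^ n" "(z, y) \<in> Adj" by auto
  obtain e where e: "disagree z y \<subseteq> {e}" using disagree_Adj[OF z(2)] by auto
  have "card (disagree x y) \<le> card (disagree x z \<union> disagree z y)"
    by (intro card_mono disagree_triangle) (simp add: finite_disagree)
  also have "\<dots> \<le> card (disagree x z) + card (disagree z y)" by (rule card_Un_le)
  also have "\<dots> \<le> n + 1"
    using Suc.IH[OF z(1)] card_mono[OF _ e] by auto
  finally show ?case by simp
qed

lemma card_disagree_le_dist:
  assumes "x \<in> CV" "y \<in> CV"
  shows "real (card (disagree x y)) \<le> cover_dist E s t T m x y"
proof -
  \<comment> \<open>Connectedness ensures that the \<open>LEAST\<close> in \<open>graph_dist\<close>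
    is attained by an actual path.\<close>
  have "\<exists>n. (x, y) \<in> Adj ^^ n"
    using cover_connected[OF assms] by (rule rtrancl_imp_relpow)
  then have "(x, y) \<in> Adj ^^ (LEAST n. (x, y) \<in> Adj ^^ n)" by (rule LeastI_ex)
  from card_disagree_relpow[OF this] show ?thesis
    by (simp add: cover_dist_def graph_dist_def)
qed

text \<open>The boundary of the difference chain at \<open>fst x\<close> would be \<open>-1\<close>
  if the base vertices differed, which is nonzero modulo \<open>m\<close>. The non-tree coordinates
  are the group coordinates, and these lie below \<open>m\<close>.\<close>

lemma disagree_empty_imp_eq:
  assumes "x \<in> CV" "y \<in> CV" "disagree x y = {}"
  shows "x = y"
proof -
  have M: "int m dvd \<Phi> y e - \<Phi> x e" if "e \<in> E" for e
    using assms(3) that by (auto simp: disagree_def)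
  obtain v0 where v0: "\<And>x w. x \<in> CV \<Longrightarrow>
      bdry E s t (\<Phi> x) w = of_bool (w = fst x) - of_bool (w = v0)"
    using lab by (auto simp: chain_labelling_def)
  have "int m dvd bdry E s t (\<lambda>e. \<Phi> y e - \<Phi> x e) (fst x)"
    unfolding bdry_def by (intro dvd_sum dvd_mult2 M)
  then have "int m dvd of_bool (fst x = fst y) - 1"
    using assms by (simp add: bdry_diff v0)
  then have 1: "fst x = fst y"
    using m2 zdvd_imp_le[of "int m" 1] by (auto simp: of_bool_def split: if_splits)
  have "snd x e = snd y e" for e
  proof (cases "e \<in> E - T")
    case True
    then have "int m dvd int (snd y e) - int (snd x e)"
      using M[of e] lab assms by (auto simp: chain_labelling_def)
    then have "int (snd y e) mod int m = int (snd x e) mod int m"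
      by (simp add: mod_eq_dvd_iff)
    moreover have "snd x e < m" "snd y e < m"
      using assms by (auto simp: cover_vertices_def cover_group_def)
    ultimately show ?thesis by simp
  next
    case False
    then show ?thesis using assms by (auto simp: cover_vertices_def cover_group_def)
  qed
  then show ?thesis using 1 by (simp add: prod_eq_iff fun_eq_iff)
qed

text \<open>Supplies the lift at \<open>x\<close> of an edge at \<open>fst x\<close>, in whichever
  direction it must be crossed, with the matching sign in the label. As \<open>e\<close> is no loop,
  exactly one of the two indicators is one.\<close>

lemma move_along_edge:
  assumes x: "x \<in> CV" and e: "e \<in> E" and end_pt: "s e = fst x \<or> t e = fst x"
    and nl: "s e \<noteq> t e"
  obtains x' where "(x, x') \<in> Adj" "x' \<in> CV"
    "\<And>f. f \<in> E \<Longrightarrow> int m dvd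
      \<Phi> x' f - \<Phi> x f - of_bool (f = e) * (of_bool (s e = fst x) - of_bool (t e = fst x))"
proof -
  obtain u k where uk: "x = (u, k)" "k \<in> KG" using x by (auto simp: cover_vertices_def)
  show thesis
  proof (cases "s e = u")
    case True
    let ?x = "(t e, if e \<in> T then k else rho_shift m e k)"
    have "(x, ?x) \<in> Adj" using cover_edge[OF e uk(2)] uk True by auto
    moreover from this have "?x \<in> CV" using Adj_in_CV by blast
    ultimately show thesis
      using edge_label[OF e uk(2)] True uk nl by (intro that[of ?x]) auto
  next
    case False
    then have te: "t e = u" using end_pt uk by auto
    obtain k' where k': "k' \<in> KG" "(if e \<in> T then k' else rho_shift m e k') = k"
    proof (cases "e \<in> T")
      case True
      then show ?thesis using that uk(2) by auto
    next
      case False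
      then show ?thesis using that rho_shift_surj[OF uk(2)] e by (metis DiffI)
    qed
    have adj: "(x, (s e, k')) \<in> Adj" using cover_edge[OF e k'(1)] uk te k'(2) by auto
    have "int m dvd \<Phi> (s e, k') f - \<Phi> x f + of_bool (f = e)" if "f \<in> E" for f
    proof -
      have "int m dvd - (\<Phi> x f - \<Phi> (s e, k') f - of_bool (f = e))"
        using edge_label[OF e k'(1) that] uk te k'(2) by (simp only: dvd_minus_iff)
      then show ?thesis by (simp add: algebra_simps)
    qed
    moreover have "(s e, k') \<in> CV" using Adj_in_CV adj by blast
    ultimately show thesis
      using adj False te uk by (intro that[of "(s e, k')"]) auto
  qed
qed

text \<open>Induction on the size of the support, which is a forest. A leaf carries nonzero
  boundary, so it lies under \<open>x\<close> or \<open>y\<close>, and the coefficient of its edge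
  is a sign modulo \<open>m\<close>. Crossing this edge from that end removes exactly it from the
  support.\<close>

lemma acyclic_disagree_relpow:
  assumes "x \<in> CV" "y \<in> CV" "\<not> (\<exists>es vs. is_cycle (disagree x y) s t es vs)"
  shows "(x, y) \<in> Adj ^^ card (disagree x y)"
  using assms
proof (induction "card (disagree x y)" arbitrary: x y)
  case 0
  then have "disagree x y = {}" using finite_disagree by auto
  then show ?case using disagree_empty_imp_eq 0 by simp
next
  case (Suc n)
  let ?c = "\<lambda>f. \<Phi> y f - \<Phi> x f"
  have ne: "disagree x y \<noteq> {}" using Suc.hyps(2) by auto
  obtain w e where we: "e \<in> disagree x y" "s e \<noteq> t e" "w = s e \<or> w = t e"
    "\<And>f. f \<in> disagree x y \<Longrightarrow> s f = w \<or> t f = w \<Longrightarrow> f = e"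
    using acyclic_has_leaf[OF finite_disagree ne Suc.prems(3)] by metis
  have eE: "e \<in> E" and ce: "\<not> int m dvd ?c e" using we(1) by (auto simp: disagree_def)
  \<comment> \<open>The incidence sign of the leaf edge at \<open>w\<close>: positive if the edge
    enters \<open>w\<close>.\<close>
  define \<epsilon> :: int where "\<epsilon> = of_bool (t e = w) - of_bool (s e = w)"
  have eps: "\<epsilon> = 1 \<or> \<epsilon> = -1" using we(2,3) by (auto simp: \<epsilon>_def)
  obtain v0 where v0: "\<And>x w. x \<in> CV \<Longrightarrow>
      bdry E s t (\<Phi> x) w = of_bool (w = fst x) - of_bool (w = v0)"
    using lab by (auto simp: chain_labelling_def)
  have "int m dvd bdry E s t ?c w - ?c e * \<epsilon>"
    unfolding \<epsilon>_def by (rule bdry_at_leaf[OF finE disagree_def[of x y] we(1)]) (use we(4) in blast)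
  then have b: "int m dvd of_bool (w = fst y) - of_bool (w = fst x) - ?c e * \<epsilon>"
    using Suc.prems by (simp add: bdry_diff v0)
  \<comment> \<open>Serves both ends: \<open>a\<close> is the change made in coordinate
    \<open>e\<close> by moving one endpoint, and it cancels the coefficient modulo
    \<open>m\<close>.\<close>
  have shrink: "(x', y') \<in> Adj ^^ n" if x': "x' \<in> CV" and y': "y' \<in> CV"
    and d: "\<And>f. f \<in> E \<Longrightarrow> int m dvd (\<Phi> y' f - \<Phi> x' f) - (?c f - of_bool (f = e) * a)"
    and a: "int m dvd ?c e - a" for x' y' a
  proof -
    have "f \<in> disagree x' y' \<longleftrightarrow> f \<in> disagree x y - {e}" if "f \<in> E" for f
    proof (cases "f = e")
      case True
      then have "int m dvd \<Phi> y' f - \<Phi> x' f"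
        using d[OF that] a by (metis dvd_diff_right_iff mult_1 of_bool_eq(2) dvd_diff_left_iff)
      then show ?thesis using True by (simp add: disagree_def)
    next
      case False
      then have "int m dvd (\<Phi> y' f - \<Phi> x' f) - ?c f" using d[OF that] by simp
      then have "int m dvd \<Phi> y' f - \<Phi> x' f \<longleftrightarrow> int m dvd ?c f"
        by (metis dvd_diff_left_iff dvd_diff_right_iff)
      then show ?thesis using False that by (simp add: disagree_def)
    qed
    then have eq: "disagree x' y' = disagree x y - {e}" by (auto simp: disagree_def)
    then have "n = card (disagree x' y')"
      using Suc.hyps(2) we(1) finite_disagree[of x y] by simp
    moreover have "\<not> (\<exists>es vs. is_cycle (disagree x' y') s t es vs)"
      using Suc.prems(3) is_cycle_mono eq by (metis Diff_subset)
    ultimately show ?thesis using Suc.hyps(1) x' y' by blast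
  qed
  have ce': "\<not> int m dvd \<Phi> x e - \<Phi> y e" using ce by (simp add: dvd_diff_commute)
  \<comment> \<open>If \<open>w\<close> were neither or both of the two vertices, \<open>b\<close>
    would make the coefficient of \<open>e\<close> divisible by \<open>m\<close>.\<close>
  have "(w = fst x \<and> w \<noteq> fst y) \<or> (w = fst y \<and> w \<noteq> fst x)"
    using b ce ce' eps by (cases "w = fst x"; cases "w = fst y") auto
  then show ?case
  proof
    assume w: "w = fst x \<and> w \<noteq> fst y"
    \<comment> \<open>The boundary at the initial vertex is \<open>-1\<close>, and \<epsilon> is its
      own inverse.\<close>
    then have a: "int m dvd ?c e - (- \<epsilon>)" using b eps by (auto simp: dvd_diff_commute algebra_simps)
    obtain x' where x': "(x, x') \<in> Adj" "x' \<in> CV"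
      "\<And>f. f \<in> E \<Longrightarrow> int m dvd
        \<Phi> x' f - \<Phi> x f - of_bool (f = e) * (of_bool (s e = fst x) - of_bool (t e = fst x))"
      using move_along_edge[OF Suc.prems(1) eE _ we(2)] we(3) w by metis
    have "(x', y) \<in> Adj ^^ n"
    proof (rule shrink[OF x'(2) Suc.prems(2) _ a])
      fix f assume "f \<in> E"
      have "of_bool (s e = fst x) - of_bool (t e = fst x) = - \<epsilon>"
        using w by (simp add: \<epsilon>_def)
      then have "int m dvd - (\<Phi> x' f - \<Phi> x f - of_bool (f = e) * (- \<epsilon>))"
        using x'(3)[OF \<open>f \<in> E\<close>] by (simp only: dvd_minus_iff)
      then show "int m dvd (\<Phi> y f - \<Phi> x' f) - (?c f - of_bool (f = e) * (- \<epsilon>))"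
        by (simp add: algebra_simps)
    qed
    then show ?thesis using x'(1) Suc.hyps(2) relpow_Suc_I2 by metis
  next
    assume w: "w = fst y \<and> w \<noteq> fst x"
    then have a: "int m dvd ?c e - \<epsilon>" using b eps by (auto simp: dvd_diff_commute algebra_simps)
    obtain y' where y': "(y, y') \<in> Adj" "y' \<in> CV"
      "\<And>f. f \<in> E \<Longrightarrow> int m dvd
        \<Phi> y' f - \<Phi> y f - of_bool (f = e) * (of_bool (s e = fst y) - of_bool (t e = fst y))"
      using move_along_edge[OF Suc.prems(2) eE _ we(2)] we(3) w by metis
    have "(x, y') \<in> Adj ^^ n"
    proof (rule shrink[OF Suc.prems(1) y'(2) _ a])
      fix f assume "f \<in> E"
      have "of_bool (s e = fst y) - of_bool (t e = fst y) = - \<epsilon>"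
        using w by (simp add: \<epsilon>_def)
      then have "int m dvd \<Phi> y' f - \<Phi> y f - of_bool (f = e) * (- \<epsilon>)"
        using y'(3)[OF \<open>f \<in> E\<close>] by (simp only: dvd_minus_iff)
      then show "int m dvd (\<Phi> y' f - \<Phi> x f) - (?c f - of_bool (f = e) * \<epsilon>)"
        by (simp add: algebra_simps)
    qed
    then show ?thesis using y'(1) Suc.hyps(2) relpow_Suc_I Adj_sym by metis
  qed
qed

text \<open>A cycle inside the support would be at most as long as the support is large, hence
  shorter than the girth.\<close>

lemma dist_le_card_disagree:
  assumes "x \<in> CV" "y \<in> CV" and girth: "enat (card (disagree x y)) < girth E s t"
  shows "cover_dist E s t T m x y \<le> real (card (disagree x y))"
proof -
  have "\<not> is_cycle (disagree x y) s t es vs" for es vs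
  proof
    assume c: "is_cycle (disagree x y) s t es vs"
    then have "is_cycle E s t es vs" by (rule is_cycle_mono) (auto simp: disagree_def)
    then have "girth E s t \<le> enat (length es)"
      unfolding girth_def by (intro Inf_lower) blast
    moreover have "length es \<le> card (disagree x y)"
      using c finite_disagree by (metis card_mono distinct_card is_cycle_def)
    ultimately show False using girth
      by (meson enat_ord_simps(1) leD order_trans)
  qed
  then have "(x, y) \<in> Adj ^^ card (disagree x y)"
    using acyclic_disagree_relpow assms by blast
  then show ?thesis
    by (simp add: cover_dist_def graph_dist_def Least_le)
qed

end

section \<open>Euclidean realisation of the Hamming distance\<close>

lemma hamming_embedding:
  "\<exists>\<phi> :: 'v \<times> ('e \<Rightarrow> nat) \<Rightarrow> 'e \<Rightarrow> real. \<forall>x\<in>CV. \<forall>y\<in>CV.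
     (\<Sum>e\<in>E. (\<phi> x e - \<phi> y e)\<^sup>2) \<le> (real m)\<^sup>2 * cover_dist E s t T m x y \<and>
     (\<forall>K. enat K \<le> girth E s t \<longrightarrow> (\<Sum>e\<in>E. (\<phi> x e - \<phi> y e)\<^sup>2) < real K \<longrightarrow>
        cover_dist E s t T m x y \<le> (\<Sum>e\<in>E. (\<phi> x e - \<phi> y e)\<^sup>2))"
proof -
  obtain \<Phi> where lab: "chain_labelling V E s t T m \<Phi>" using chain_labelling_exists by blast
  \<comment> \<open>Residues in \<open>{0..<m}\<close> that disagree differ by at least
    \<open>1\<close> and at most \<open>m\<close>, so the squared Euclidean distance lies between
    the Hamming distance and \<open>m^2\<close> times it.\<close>
  define \<phi> where "\<phi> x e = real_of_int (\<Phi> x e mod int m)" for x e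
  let ?A = "disagree \<Phi>" and ?S = "\<lambda>x y. \<Sum>e\<in>E. (\<phi> x e - \<phi> y e)\<^sup>2"
  have term0: "(\<phi> x e - \<phi> y e)\<^sup>2 = 0" if "e \<in> E" "e \<notin> ?A x y" for x y e
  proof -
    have "int m dvd \<Phi> y e - \<Phi> x e" using that by (auto simp: disagree_def[OF lab])
    then have "\<Phi> y e mod int m = \<Phi> x e mod int m" by (simp add: mod_eq_dvd_iff)
    then show ?thesis by (simp add: \<phi>_def)
  qed
  have term1: "1 \<le> (\<phi> x e - \<phi> y e)\<^sup>2 \<and> (\<phi> x e - \<phi> y e)\<^sup>2 \<le> (real m)\<^sup>2" if "e \<in> ?A x y" for x y e
  proof -
    let ?d = "\<Phi> x e mod int m - \<Phi> y e mod int m"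
    have "\<Phi> y e mod int m \<noteq> \<Phi> x e mod int m"
      using that by (auto simp: disagree_def[OF lab] mod_eq_dvd_iff)
    then have "1 \<le> \<bar>?d\<bar>" by auto
    moreover have "\<bar>?d\<bar> \<le> int m"
      using m2 pos_mod_bound[of "int m" "\<Phi> x e"] pos_mod_bound[of "int m" "\<Phi> y e"]
        pos_mod_sign[of "int m" "\<Phi> x e"] pos_mod_sign[of "int m" "\<Phi> y e"] by linarith
    ultimately have "1 \<le> \<bar>\<phi> x e - \<phi> y e\<bar>" "\<bar>\<phi> x e - \<phi> y e\<bar> \<le> real m"
      by (simp_all add: \<phi>_def flip: of_int_diff of_int_abs)
    then show ?thesis
      using abs_le_square_iff[of 1 "\<phi> x e - \<phi> y e"] abs_le_square_iff[of "\<phi> x e - \<phi> y e" "real m"]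
      by simp
  qed
  have sum_eq: "?S x y = (\<Sum>e\<in>?A x y. (\<phi> x e - \<phi> y e)\<^sup>2)" for x y
    by (rule sum.mono_neutral_right[OF finE]) (use term0 in \<open>auto simp: disagree_def[OF lab]\<close>)
  have lo: "real (card (?A x y)) \<le> ?S x y" for x y
    unfolding sum_eq using sum_mono[of "?A x y" "\<lambda>_. 1" "\<lambda>e. (\<phi> x e - \<phi> y e)\<^sup>2"] term1 by simp
  have hi: "?S x y \<le> (real m)\<^sup>2 * real (card (?A x y))" for x y
    unfolding sum_eq using sum_mono[of "?A x y" "\<lambda>e. (\<phi> x e - \<phi> y e)\<^sup>2" "\<lambda>_. (real m)\<^sup>2"] term1
    by (simp add: mult.commute)
  have "?S x y \<le> (real m)\<^sup>2 * cover_dist E s t T m x y" if "x \<in> CV" "y \<in> CV" for x y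
    using hi[of x y] card_disagree_le_dist[OF lab that]
    by (meson mult_left_mono order_trans zero_le_power2)
  moreover have "cover_dist E s t T m x y \<le> ?S x y"
    if "x \<in> CV" "y \<in> CV" and K: "enat K \<le> girth E s t" "?S x y < real K" for x y K
  proof -
    have "card (?A x y) < K" using lo[of x y] K(2) by simp
    then have "enat (card (?A x y)) < girth E s t" using K(1) by (meson enat_ord_simps(2) less_le_trans)
    then show ?thesis using dist_le_card_disagree[OF lab that(1,2)] lo[of x y] by linarith
  qed
  ultimately show ?thesis by blast
qed

end

section \<open>Coarse embeddings\<close>

lemma summable_square_diff:
  fixes f g :: "nat \<Rightarrow> real"
  assumes "summable (\<lambda>i. (f i)\<^sup>2)" "summable (\<lambda>i. (g i)\<^sup>2)"
  shows "summable (\<lambda>i. (f i - g i)\<^sup>2)"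
proof (rule summable_comparison_test')
  show "summable (\<lambda>i. 2 * ((f i)\<^sup>2 + (g i)\<^sup>2))"
    using assms by (intro summable_mult summable_add)
  fix i :: nat
  have "(f i - g i)\<^sup>2 \<le> 2 * ((f i)\<^sup>2 + (g i)\<^sup>2)"
    using zero_le_power2[of "f i + g i"] by (simp add: power2_sum power2_diff)
  then show "norm ((f i - g i)\<^sup>2) \<le> 2 * ((f i)\<^sup>2 + (g i)\<^sup>2)" by simp
qed

lemma abs_coordinate_le_l2_dist:
  assumes "summable (\<lambda>i. (f i)\<^sup>2)" "summable (\<lambda>i. (g i)\<^sup>2)"
  shows "\<bar>f i - g i\<bar> \<le> l2_dist f g"
proof -
  have "(\<Sum>j\<in>{i}. (f j - g j)\<^sup>2) \<le> (\<Sum>j. (f j - g j)\<^sup>2)"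
    by (rule sum_le_suminf) (use summable_square_diff[OF assms] in auto)
  then show ?thesis unfolding l2_dist_def by (intro real_le_rsqrt) simp
qed

text \<open>The control functions are built from the extremal Hilbert distances over pairs at
  distance at most \<open>x\<close> and at least \<open>x\<close>.\<close>

lemma coarsely_embeds_into_l2I:
  fixes F :: "'p \<Rightarrow> nat \<Rightarrow> real" and D :: "'p \<Rightarrow> 'p \<Rightarrow> real"
  assumes summ: "\<And>p. p \<in> U \<Longrightarrow> summable (\<lambda>i. (F p i)\<^sup>2)"
    and D_nonneg: "\<And>p q. p \<in> U \<Longrightarrow> q \<in> U \<Longrightarrow> 0 \<le> D p q"
    and upper: "\<And>R. \<exists>B. \<forall>p\<in>U. \<forall>q\<in>U. D p q \<le> R \<longrightarrow> l2_dist (F p) (F q) \<le> B"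
    and lower: "\<And>R. \<exists>B. \<forall>p\<in>U. \<forall>q\<in>U. l2_dist (F p) (F q) \<le> R \<longrightarrow> D p q \<le> B"
  shows "coarsely_embeds_into_l2 U D"
proof -
  have nonneg: "0 \<le> l2_dist (F p) (F q)" if "p \<in> U" "q \<in> U" for p q
    using abs_coordinate_le_l2_dist[OF summ summ, of p q 0] that by linarith
  define A where "A x = insert 0 {l2_dist (F p) (F q) |p q. p \<in> U \<and> q \<in> U \<and> D p q \<le> x}" for x
  \<comment> \<open>Inserting \<open>x\<close> keeps the set nonempty, so that its infimum is
    meaningful, and does not prevent divergence.\<close>
  define C where "C x = insert x {l2_dist (F p) (F q) |p q. p \<in> U \<and> q \<in> U \<and> x \<le> D p q}" for x
  \<comment> \<open>The summand \<open>x\<close> forces divergence even if the suprema stay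
    bounded.\<close>
  define rp where "rp x = x + Sup (A x)" for x
  define rm where "rm x = Inf (C x)" for x
  have bA: "bdd_above (A x)" for x
  proof -
    obtain B where "\<forall>p\<in>U. \<forall>q\<in>U. D p q \<le> x \<longrightarrow> l2_dist (F p) (F q) \<le> B" using upper by blast
    then show ?thesis by (intro bdd_aboveI[of _ "max 0 B"]) (auto simp: A_def le_max_iff_disj)
  qed
  have bC: "bdd_below (C x)" for x
    by (rule bdd_belowI[of _ "min 0 x"]) (auto simp: C_def min_le_iff_disj nonneg)
  have SupA: "0 \<le> Sup (A x)" for x
    by (rule cSup_upper[OF _ bA]) (simp add: A_def)
  have "mono_on {0..} rp"
  proof (rule mono_onI)
    fix x y :: real assume "x \<le> y"
    moreover from this have "Sup (A x) \<le> Sup (A y)"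
      by (intro cSup_subset_mono bA) (force simp: A_def)+
    ultimately show "rp x \<le> rp y" by (simp add: rp_def)
  qed
  moreover have "mono_on {0..} rm"
  proof (rule mono_onI)
    fix x y :: real assume xy: "x \<le> y"
    show "rm x \<le> rm y"
      unfolding rm_def
    proof (rule cInf_greatest)
      fix z assume z: "z \<in> C y"
      show "Inf (C x) \<le> z"
      proof (cases "z = y")
        case True
        have "Inf (C x) \<le> x" by (rule cInf_lower[OF _ bC]) (simp add: C_def)
        then show ?thesis using True xy by simp
      next
        case False
        then have "z \<in> C x" using z xy unfolding C_def by force
        then show ?thesis by (rule cInf_lower[OF _ bC])
      qed
    qed (simp add: C_def)
  qed
  moreover have "filterlim rp at_top at_top"
    by (rule filterlim_at_top_mono[OF filterlim_ident]) (simp add: rp_def SupA)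
  moreover have "filterlim rm at_top at_top"
    unfolding filterlim_at_top
  proof
    fix Z :: real
    obtain B where B: "\<forall>p\<in>U. \<forall>q\<in>U. l2_dist (F p) (F q) \<le> Z \<longrightarrow> D p q \<le> B" using lower by blast
    \<comment> \<open>Pairs at distance beyond \<open>B\<close> have Hilbert distance above
      \<open>Z\<close>, and the inserted element \<open>x\<close> exceeds \<open>Z\<close> as
      well.\<close>
    have "Z \<le> rm x" if "x > max Z B" for x
      unfolding rm_def
    proof (rule cInf_greatest)
      fix z assume "z \<in> C x"
      then show "Z \<le> z" using B that unfolding C_def by fastforce
    qed (simp add: C_def)
    then show "\<forall>\<^sub>F x in at_top. Z \<le> rm x"
      using eventually_gt_at_top[of "max Z B"] by (rule eventually_mono[rotated])
  qed
  moreover have "0 \<le> rm x \<and> 0 \<le> rp x" if "0 \<le> x" for x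
    unfolding rm_def rp_def using SupA[of x] that
    by (auto intro!: cInf_greatest simp: C_def nonneg)
  moreover have "rm (D p q) \<le> l2_dist (F p) (F q)" if "p \<in> U" "q \<in> U" for p q
    unfolding rm_def by (rule cInf_lower[OF _ bC]) (use that in \<open>auto simp: C_def\<close>)
  moreover have "l2_dist (F p) (F q) \<le> rp (D p q)" if "p \<in> U" "q \<in> U" for p q
  proof -
    have "l2_dist (F p) (F q) \<le> Sup (A (D p q))"
      by (rule cSup_upper[OF _ bA]) (use that in \<open>auto simp: A_def\<close>)
    then show ?thesis using D_nonneg[OF that] by (simp add: rp_def)
  qed
  ultimately show ?thesis
    unfolding coarsely_embeds_into_l2_def using summ
    by (intro exI[of _ F] exI[of _ rm] exI[of _ rp] conjI ballI allI impI) simp_all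
qed

section \<open>Embedding of the coarse disjoint union\<close>

theorem mainTheorem2:
  fixes V :: "nat \<Rightarrow> 'v set" and E :: "nat \<Rightarrow> 'e set"
    and s t :: "nat \<Rightarrow> 'e \<Rightarrow> 'v" and T :: "nat \<Rightarrow> 'e set" and m :: nat
    and D :: "(nat \<times> ('v \<times> ('e \<Rightarrow> nat))) \<Rightarrow> (nat \<times> ('v \<times> ('e \<Rightarrow> nat))) \<Rightarrow> real"
  assumes "3 \<le> m"
    and "\<And>n. finite_graph (V n) (E n) (s n) (t n)"
    and "\<And>n. graph_connected (V n) (E n) (s n) (t n)"
    and "\<And>n. two_connected (V n) (E n) (s n) (t n)"
    and "\<And>n. \<exists>c. \<forall>e\<in>E n. card {Tr. spanning_tree (V n) (E n) (s n) (t n) Tr \<and> e \<notin> Tr} = c"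
    and "\<And>n. spanning_tree (V n) (E n) (s n) (t n) (T n)"
    and "\<And>K::nat. eventually (\<lambda>n. enat K \<le> girth (E n) (s n) (t n)) sequentially"
    and "coarse_disjoint_union_metric (\<lambda>n. cover_vertices (V n) (E n) (T n) m)
           (\<lambda>n. cover_dist (E n) (s n) (t n) (T n) m) D"
  shows "coarsely_embeds_into_l2 (SIGMA n:UNIV. cover_vertices (V n) (E n) (T n) m) D"
proof -
  let ?CV = "\<lambda>n. cover_vertices (V n) (E n) (T n) m"
  let ?d = "\<lambda>n. cover_dist (E n) (s n) (t n) (T n) m"
  let ?U = "SIGMA n:UNIV. ?CV n"
  have hc: "homology_cover (V n) (E n) (s n) (t n) (T n) m" for n
    using assms(1,2,6) by (auto simp: homology_cover_def)
  note metric = assms(8)[unfolded coarse_disjoint_union_metric_def]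
  have D_nonneg: "0 \<le> D p q" if "p \<in> ?U" "q \<in> ?U" for p q
    using conjunct1[OF metric] that by blast
  have D_same: "D (n, x) (n, y) = ?d n x y" if "x \<in> ?CV n" "y \<in> ?CV n" for n x y
    using conjunct1[OF conjunct2[OF metric]] that by blast
  have D_far: "\<exists>N. \<forall>n n' x y. n \<noteq> n' \<and> N \<le> max n n' \<and> x \<in> ?CV n \<and> y \<in> ?CV n' \<longrightarrow>
      R \<le> D (n, x) (n', y)" for R
    using conjunct2[OF conjunct2[OF conjunct2[OF metric]]] by (rule spec)
  have finCV: "finite (?CV n)" for n using homology_cover.finite_CV[OF hc] .
  have finE: "finite (E n)" for n using assms(2) by (auto simp: finite_graph_def)
  have "\<exists>\<phi> :: nat \<Rightarrow> 'v \<times> ('e \<Rightarrow> nat) \<Rightarrow> 'e \<Rightarrow> real. \<forall>n. \<forall>x\<in>?CV n. \<forall>y\<in>?CV n.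
     (\<Sum>e\<in>E n. (\<phi> n x e - \<phi> n y e)\<^sup>2) \<le> (real m)\<^sup>2 * ?d n x y \<and>
     (\<forall>K. enat K \<le> girth (E n) (s n) (t n) \<longrightarrow> (\<Sum>e\<in>E n. (\<phi> n x e - \<phi> n y e)\<^sup>2) < real K \<longrightarrow>
        ?d n x y \<le> (\<Sum>e\<in>E n. (\<phi> n x e - \<phi> n y e)\<^sup>2))"
    by (intro choice allI homology_cover.hamming_embedding hc)
  then obtain \<phi> :: "nat \<Rightarrow> 'v \<times> ('e \<Rightarrow> nat) \<Rightarrow> 'e \<Rightarrow> real" where
    phi_upper: "\<And>n x y. x \<in> ?CV n \<Longrightarrow> y \<in> ?CV n \<Longrightarrow>
      (\<Sum>e\<in>E n. (\<phi> n x e - \<phi> n y e)\<^sup>2) \<le> (real m)\<^sup>2 * ?d n x y" and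
    phi_lower: "\<And>n x y K. x \<in> ?CV n \<Longrightarrow> y \<in> ?CV n \<Longrightarrow> enat K \<le> girth (E n) (s n) (t n) \<Longrightarrow>
      (\<Sum>e\<in>E n. (\<phi> n x e - \<phi> n y e)\<^sup>2) < real K \<Longrightarrow>
      ?d n x y \<le> (\<Sum>e\<in>E n. (\<phi> n x e - \<phi> n y e)\<^sup>2)"
    by blast
  obtain b where b: "\<And>n. bij_betw (b n) {..<card (E n)} (E n)"
    using ex_bij_betw_nat_finite[OF finE] unfolding atLeast0LessThan by metis
  \<comment> \<open>Coordinate \<open>0\<close> separates the components; the edge coordinates
    follow, enumerated by \<open>b\<close> and padded with zeros.\<close>
  define F where "F p i = (case i of 0 \<Rightarrow> (real (fst p))\<^sup>2
      | Suc j \<Rightarrow> if j < card (E (fst p)) then \<phi> (fst p) (snd p) (b (fst p) j) else 0)"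
    for p and i :: nat
  have F_zero: "F p i = 0" if "i \<notin> {..card (E (fst p))}" for p i
    using that by (auto simp: F_def split: nat.splits)
  have summF: "summable (\<lambda>i. (F p i)\<^sup>2)" for p
    by (rule summable_finite[of "{..card (E (fst p))}"]) (use F_zero in auto)
  have dist_same: "(l2_dist (F (n, x)) (F (n, y)))\<^sup>2 = (\<Sum>e\<in>E n. (\<phi> n x e - \<phi> n y e)\<^sup>2)" for n x y
  proof -
    have "(\<Sum>i. (F (n, x) i - F (n, y) i)\<^sup>2) = (\<Sum>i<Suc (card (E n)). (F (n, x) i - F (n, y) i)\<^sup>2)"
      by (rule suminf_finite) (auto simp: F_zero)
    also have "\<dots> = (\<Sum>j<card (E n). (\<phi> n x (b n j) - \<phi> n y (b n j))\<^sup>2)"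
      unfolding sum.lessThan_Suc_shift by (simp add: F_def)
    also have "\<dots> = (\<Sum>e\<in>E n. (\<phi> n x e - \<phi> n y e)\<^sup>2)"
      by (rule sum.reindex_bij_betw[OF b])
    finally show ?thesis by (simp add: l2_dist_def sum_nonneg)
  qed
  have dist_diff: "real (max n n') \<le> l2_dist (F (n, x)) (F (n', y))" if "n \<noteq> n'" for n n' x y
  proof -
    have "real (max n n') \<le> 1 * (real n + real n')" by simp
    also have "\<dots> \<le> \<bar>real n - real n'\<bar> * (real n + real n')"
      \<comment> \<open>Distinct natural numbers differ by at least one.\<close>
      using that by (intro mult_right_mono) auto
    also have "\<dots> = \<bar>(real n)\<^sup>2 - (real n')\<^sup>2\<bar>"
      by (simp add: abs_mult power2_eq_square square_diff_square_factored)
    also have "\<dots> \<le> l2_dist (F (n, x)) (F (n', y))"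
      using abs_coordinate_le_l2_dist[OF summF summF, of "(n, x)" 0 "(n', y)"]
      by (simp add: F_def[where i = 0])
    finally show ?thesis .
  qed
  \<comment> \<open>The components up to index \<open>N\<close> contain finitely many points in
    total.\<close>
  have bounded: "\<exists>B. \<forall>p\<in>?U. \<forall>q\<in>?U. fst p \<le> N \<and> fst q \<le> N \<longrightarrow> g p q \<le> B"
    for N and g :: "_ \<Rightarrow> _ \<Rightarrow> real"
  proof -
    let ?W = "SIGMA n:{..N}. ?CV n"
    have "finite ((\<lambda>(p, q). g p q) ` (?W \<times> ?W))" using finCV by auto
    then obtain B where "\<forall>r\<in>(\<lambda>(p, q). g p q) ` (?W \<times> ?W). r \<le> B"
      by (meson bdd_above_def bdd_above_finite)
    then show ?thesis by (intro exI[of _ B]) fastforce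
  qed
  show ?thesis
  proof (rule coarsely_embeds_into_l2I[where F = F])
    show "summable (\<lambda>i. (F p i)\<^sup>2)" for p by (rule summF)
    show "0 \<le> D p q" if "p \<in> ?U" "q \<in> ?U" for p q
      using D_nonneg that .
    show "\<exists>B. \<forall>p\<in>?U. \<forall>q\<in>?U. D p q \<le> R \<longrightarrow> l2_dist (F p) (F q) \<le> B" for R
    proof -
      \<comment> \<open>With \<open>R + 1\<close> in place of \<open>R\<close>, pairs in different
        components at distance at most \<open>R\<close> must have both indices below
        \<open>N\<close>.\<close>
      obtain N where N: "\<And>n n' x y. n \<noteq> n' \<Longrightarrow> N \<le> max n n' \<Longrightarrow> x \<in> ?CV n \<Longrightarrow> y \<in> ?CV n' \<Longrightarrow>
          R + 1 \<le> D (n, x) (n', y)"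
        using D_far[of "R + 1"] by blast
      obtain B where B: "\<And>p q. p \<in> ?U \<Longrightarrow> q \<in> ?U \<Longrightarrow> fst p \<le> N \<Longrightarrow> fst q \<le> N \<Longrightarrow>
          l2_dist (F p) (F q) \<le> B"
        using bounded[of N "\<lambda>p q. l2_dist (F p) (F q)"] by blast
      have "l2_dist (F (n, x)) (F (n', y)) \<le> max B (real m * sqrt R)"
        if x: "x \<in> ?CV n" and y: "y \<in> ?CV n'" and R: "D (n, x) (n', y) \<le> R" for n x n' y
      proof (cases "n = n'")
        case True
        then have d: "?d n x y \<le> R" using D_same x y R by simp
        have "(l2_dist (F (n, x)) (F (n, y)))\<^sup>2 \<le> (real m)\<^sup>2 * R"
          unfolding dist_same using phi_upper[of x n y] x y True mult_left_mono[OF d, of "(real m)\<^sup>2"]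
          by simp
        then have "l2_dist (F (n, x)) (F (n, y)) \<le> real m * sqrt R"
          using real_le_rsqrt[of "l2_dist (F (n, x)) (F (n, y))" "(real m)\<^sup>2 * R"]
          by (simp add: real_sqrt_mult)
        then show ?thesis using True by simp
      next
        case False
        have "\<not> N \<le> max n n'" using N[OF False _ x y] R by linarith
        then have "n \<le> N" "n' \<le> N" by auto
        then show ?thesis using B[of "(n, x)" "(n', y)"] x y by auto
      qed
      then show ?thesis by blast
    qed
    show "\<exists>B. \<forall>p\<in>?U. \<forall>q\<in>?U. l2_dist (F p) (F q) \<le> R \<longrightarrow> D p q \<le> B" for R
    proof -
      \<comment> \<open>Any girth of at least \<open>K\<close> exceeds the squared Hilbert distances
        considered, so \<open>phi_lower\<close> applies from \<open>N0\<close> on.\<close>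
      obtain K :: nat where K: "R\<^sup>2 < real K" using reals_Archimedean2 by blast
      obtain N0 where N0: "\<And>n. N0 \<le> n \<Longrightarrow> enat K \<le> girth (E n) (s n) (t n)"
        using assms(7)[of K] unfolding eventually_sequentially by blast
      obtain N1 :: nat where N1: "R < real N1" using reals_Archimedean2 by blast
      obtain B where B: "\<And>p q. p \<in> ?U \<Longrightarrow> q \<in> ?U \<Longrightarrow> fst p \<le> max N0 N1 \<Longrightarrow> fst q \<le> max N0 N1 \<Longrightarrow>
          D p q \<le> B"
        using bounded[of "max N0 N1" D] by blast
      have "D (n, x) (n', y) \<le> max B (R\<^sup>2)"
        if x: "x \<in> ?CV n" and y: "y \<in> ?CV n'" and R: "l2_dist (F (n, x)) (F (n', y)) \<le> R" for n x n' y
      \<comment> \<open>The remaining pairs lie in one component below \<open>N0\<close>, or in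
        different components, whose indices \<open>dist_diff\<close> bounds by \<open>R\<close>,
        hence by \<open>N1\<close>. Both kinds are covered by \<open>B\<close>.\<close>
      proof (cases "n = n' \<and> N0 \<le> n")
        case True
        have "0 \<le> l2_dist (F (n, x)) (F (n', y))"
          using abs_coordinate_le_l2_dist[OF summF summF, of "(n, x)" 0 "(n', y)"] by linarith
        then have "(l2_dist (F (n, x)) (F (n', y)))\<^sup>2 \<le> R\<^sup>2" using R by (simp add: power_mono)
        then have le: "(\<Sum>e\<in>E n. (\<phi> n x e - \<phi> n y e)\<^sup>2) \<le> R\<^sup>2" using True dist_same by metis
        then have "?d n x y \<le> R\<^sup>2"
          using phi_lower[of x n y K] x y True N0 K by fastforce
        moreover have "D (n, x) (n', y) = ?d n x y" using D_same x y True by simp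
        ultimately show ?thesis by simp
      next
        case False
        have "n \<le> max N0 N1 \<and> n' \<le> max N0 N1"
        proof (cases "n = n'")
          case False
          then show ?thesis using dist_diff[of n n' x y] R N1 by auto
        qed (use False in auto)
        then show ?thesis using B[of "(n, x)" "(n', y)"] x y by auto
      qed
      then show ?thesis by blast
    qed
  qed
qed

end
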